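(* Let $L\ge2$ be an integer. Consider any discrete memoryless channel $W_{\mathbf{y}|\mathbf{x}}$ with input alphabet $\mathcal{X}$, output alphabet $\mathcal{Y}$, and input constraints $\mathcal{P}_f\subset\Delta(\mathcal{X})$ for some cost function $f:\mathcal{X}\to\mathbb{R}$. For $P_{\mathbf{x}}\in\mathcal{P}_f$ and $\delta>0$ let $$Z=\sum_{x\in\mathcal{X}^n}\left(\prod_{i=1}^nP_{\mathbf{x}}(x(i))\right)\mathbf{1}\left\{\sum_{i=1}^nf(x(i))\in[-\delta,0]\right\}.$$ Then there exists a code $\mathcal{C}\subset\mathcal{X}^n$ of rate $R$, satisfying the input constraints $\mathcal{P}_f$ and $$P_{\mathrm{e},\mathrm{avg},L-1}(\mathcal{C})\le\min_{P_{\mathbf{x}}\in\mathcal{P}_f}\ \inf_{\delta>0}\ \min_{s\ge0,\,0\le\rho\le1}2^{nR(L-1)\rho}\left(\frac{e^{s\delta}}{Z}\right)^{1+(L-1)\rho}\left[\sum_{y\in\mathcal{Y}}\left(\sum_{x\in\mathcal{X}}P_{\mathbf{x}}(x)e^{sf(x)}W_{\mathbf{y}|\mathbf{x}}(y|x)^{\frac1{1+(L-1)\rho}}\right)^{1+(L-1)\rho}\right]^n.$$ For the same channel, there also exists a code $\mathcal{C}\subset\mathcal{X}^n$ of rate $R$, satisfying the input constraints $\mathcal{P}_f$ and $$P_{\mathrm{e},\mathrm{avg},L-1}(\mathcal{C})\le\min_{P_{\mathbf{x}}\in\mathcal{P}_f}\ \inf_{\delta>0}\ \min_{s\ge0,\,\rho\ge1}2^{L\rho}\,2^{nR(L-1)\rho}\left(\frac{e^{s\delta}}{Z}\right)^{L\rho}\left[\sum_{(x_0,\dots,x_{L-1})\in\mathcal{X}^L}\left(e^{s\sum_{k=0}^{L-1}f(x_k)}\prod_{k=0}^{L-1}P_{\mathbf{x}}(x_k)\right)\left(\sum_{y\in\mathcal{Y}}\prod_{i=0}^{L-1}W_{\mathbf{y}|\mathbf{x}}(y|x_i)^{1/L}\right)^{1/\rho}\right]^{\rho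 n}.$$
   Context: $\Delta(\mathcal{X})$ is the set of probability distributions on $\mathcal{X}$. $\mathcal{P}_f=\{P_{\mathbf{x}}\in\Delta(\mathcal{X}):\sum_{x}P_{\mathbf{x}}(x)f(x)\le0\}$; a code satisfies the input constraints $\mathcal{P}_f$ if every codeword $x\in\mathcal{X}^n$ has empirical distribution in $\mathcal{P}_f$, i.e. $\sum_{i=1}^nf(x(i))\le0$. A discrete memoryless channel is given by discrete alphabets $\mathcal{X},\mathcal{Y}$ and conditional probabilities $W_{\mathbf{y}|\mathbf{x}}(y|x)$; input $x\in\mathcal{X}^n$ produces output $y\in\mathcal{Y}^n$ with probability $\prod_{j}W_{\mathbf{y}|\mathbf{x}}(y(j)|x(j))$. A code of blocklength $n$ is a codebook $\mathcal{C}=\{x_i\}_{i=1}^M$ of $M$ indexed codewords in $\mathcal{X}^n$ (repetitions allowed), of rate $R=\frac1n\log_2M$, equipped with an $(L-1)$-list-decoder assigning to each $y\in\mathcal{Y}^n$ a set of $L-1$ indices in $\{1,\dots,M\}$. $P_{\mathrm{e},L-1}(i,\mathcal{C})$ is the probability that, when $x_i$ is sent, the decoder's output list does not contain $i$, and $P_{\mathrm{e},\mathrm{avg},L-1}(\mathcal{C})=\frac1M\sum_iP_{\mathrm{e},L-1}(i,\mathcal{C})$. The bounds are read as $+\infty$ when $Z=0$. *)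

theory Defs
  imports "HOL-Probability.Probability"
begin

definition words :: "nat \<Rightarrow> (nat \<Rightarrow> 'a) set" where
  "words n = {..<n} \<rightarrow>\<^sub>E UNIV"

definition input_constraints :: "('x::finite \<Rightarrow> real) \<Rightarrow> 'x pmf set" where
  "input_constraints f = {P. (\<Sum>x\<in>UNIV. pmf P x * f x) \<le> 0}"

definition empirical_pmf :: "nat \<Rightarrow> (nat \<Rightarrow> 'x) \<Rightarrow> 'x pmf" where
  "empirical_pmf n x = map_pmf x (pmf_of_set {..<n})"

lemma empirical_pmf_in_input_constraints_iff:
  fixes f :: "'x::finite \<Rightarrow> real"
  assumes "n \<ge> 1"
  shows "empirical_pmf n x \<in> input_constraints f \<longleftrightarrow> (\<Sum>i<n. f (x i)) \<le> 0"
proof -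
  have ne: "{..<n} \<noteq> {}" using assms by (simp add: lessThan_empty_iff)
  have "(\<Sum>a\<in>UNIV. pmf (empirical_pmf n x) a * f a)
      = measure_pmf.expectation (empirical_pmf n x) f"
    by (subst integral_measure_pmf_real[where A = UNIV]) (auto simp: mult.commute)
  also have "\<dots> = (\<Sum>i<n. f (x i)) / real n"
    unfolding empirical_pmf_def using ne by (simp add: integral_pmf_of_set)
  finally show ?thesis
    using assms by (simp add: input_constraints_def divide_le_0_iff)
qed

text \<open>A codebook is indexed by \<open>{1..size}\<close>; codewords may repeat.\<close>

record ('x, 'y) code =
  code_size :: nat
  codeword :: "nat \<Rightarrow> nat \<Rightarrow> 'x"
  decoder :: "(nat \<Rightarrow> 'y) \<Rightarrow> nat set"

definition list_code :: "nat \<Rightarrow> nat \<Rightarrow> ('x, 'y) code \<Rightarrow> bool" where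
  "list_code n l C \<longleftrightarrow>
     code_size C \<ge> 1 \<and>
     (\<forall>i\<in>{1..code_size C}. codeword C i \<in> words n) \<and>
     (\<forall>y\<in>words n. decoder C y \<subseteq> {1..code_size C} \<and> card (decoder C y) = l)"

definition code_rate :: "nat \<Rightarrow> ('x, 'y) code \<Rightarrow> real" where
  "code_rate n C = log 2 (real (code_size C)) / real n"

definition satisfies_constraints ::
    "nat \<Rightarrow> 'x pmf set \<Rightarrow> ('x, 'y) code \<Rightarrow> bool" where
  "satisfies_constraints n S C \<longleftrightarrow>
     (\<forall>i\<in>{1..code_size C}. empirical_pmf n (codeword C i) \<in> S)"

definition channel_output ::
    "('x \<Rightarrow> 'y pmf) \<Rightarrow> nat \<Rightarrow> (nat \<Rightarrow> 'x) \<Rightarrow> (nat \<Rightarrow> 'y) pmf" where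
  "channel_output W n x = Pi_pmf {..<n} undefined (\<lambda>j. W (x j))"

lemma pmf_channel_output:
  assumes "y \<in> words n"
  shows "pmf (channel_output W n x) y = (\<Prod>j<n. pmf (W (x j)) (y j))"
  using assms unfolding channel_output_def words_def
  by (subst pmf_Pi') (auto simp: PiE_def extensional_def)

definition error_prob ::
    "('x \<Rightarrow> 'y pmf) \<Rightarrow> nat \<Rightarrow> ('x, 'y) code \<Rightarrow> nat \<Rightarrow> real" where
  "error_prob W n C i =
     measure_pmf.prob (channel_output W n (codeword C i)) {y. i \<notin> decoder C y}"

definition avg_error_prob ::
    "('x \<Rightarrow> 'y pmf) \<Rightarrow> nat \<Rightarrow> ('x, 'y) code \<Rightarrow> real" where
  "avg_error_prob W n C =
     (\<Sum>i = 1..code_size C. error_prob W n C i) / real (code_size C)"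

definition shell_prob ::
    "('x::finite \<Rightarrow> real) \<Rightarrow> nat \<Rightarrow> 'x pmf \<Rightarrow> real \<Rightarrow> real" where
  "shell_prob f n P \<delta> =
     (\<Sum>x\<in>words n. (\<Prod>i<n. pmf P (x i)) * indicator {-\<delta>..0} (\<Sum>i<n. f (x i)))"

definition random_coding_bound ::
    "('x::finite \<Rightarrow> 'y::finite pmf) \<Rightarrow> ('x \<Rightarrow> real) \<Rightarrow> nat \<Rightarrow> nat \<Rightarrow> real \<Rightarrow>
     'x pmf \<Rightarrow> real \<Rightarrow> real \<Rightarrow> real \<Rightarrow> ereal" where
  "random_coding_bound W f L n R P \<delta> s \<rho> =
     (let Z = shell_prob f n P \<delta>; a = 1 + (real L - 1) * \<rho> in
      if Z = 0 then \<infinity>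
      else ereal (2 powr (real n * R * (real L - 1) * \<rho>)
        * (exp (s * \<delta>) / Z) powr a
        * (\<Sum>y\<in>UNIV. (\<Sum>x\<in>UNIV. pmf P x * exp (s * f x) * pmf (W x) y powr (1 / a)) powr a) ^ n))"

definition expurgated_bound ::
    "('x::finite \<Rightarrow> 'y::finite pmf) \<Rightarrow> ('x \<Rightarrow> real) \<Rightarrow> nat \<Rightarrow> nat \<Rightarrow> real \<Rightarrow>
     'x pmf \<Rightarrow> real \<Rightarrow> real \<Rightarrow> real \<Rightarrow> ereal" where
  "expurgated_bound W f L n R P \<delta> s \<rho> =
     (let Z = shell_prob f n P \<delta> in
      if Z = 0 then \<infinity>
      else ereal (2 powr (real L * \<rho>) * 2 powr (real n * R * (real L - 1) * \<rho>)
        * (exp (s * \<delta>) / Z) powr (real L * \<rho>)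
        * (\<Sum>x\<in>words L.
             (exp (s * (\<Sum>k<L. f (x k))) * (\<Prod>k<L. pmf P (x k)))
             * (\<Sum>y\<in>UNIV. \<Prod>i<L. pmf (W (x i)) y powr (1 / real L)) powr (1 / \<rho>))
          powr (\<rho> * real n)))"

end

theory Submission
  imports Defs
begin

text \<open>
  Both bounds come from random codebooks, decoded to the \<open>L - 1\<close> most likely messages. A message is
  missed only if \<open>L - 1\<close> others, its rivals, are all at least as likely, and this event is bounded
  through likelihood ratios raised to a suitable power, as in Gallager's treatment of ordinary
  decoding.

  For the random coding bound (\<open>random_coding_one_shot\<close>) the error indicator is bounded by the power
  \<open>\<rho> \<le> 1\<close> of a sum over groups of rivals (\<open>error_weight_le_tilted\<close>); independence of the codewords
  and Jensen's inequality give the mean over codebooks. For the expurgated bound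
  (\<open>expurgated_one_shot\<close>) the error probability is bounded by a sum of Bhattacharyya coefficients of
  \<open>L\<close> codewords, its power \<open>1 / \<rho>\<close> is averaged over codebooks of \<open>2 * M - 1\<close> codewords, and \<open>M\<close>
  codewords with small bounds are kept.

  Both arguments treat the channel with input alphabet \<open>X^n\<close> as a single use of an abstract
  channel. The codewords are drawn from the product distribution conditioned on the shell of words
  whose cost lies in \<open>[-\<delta>, 0]\<close>, which enforces the constraint. Its probabilities are at most
  \<open>exp (s * \<delta>) / Z\<close> times those of a product weight (\<open>pmf_shell_pmf_le\<close>), and for a product weight
  the sums over words become \<open>n\<close>-th powers of sums over letters
  (\<open>random_coding_exponent_tensorizes\<close>, \<open>expurgated_exponent_tensorizes\<close>).

  This yields a code for each choice of the distribution, \<open>\<delta>\<close>, \<open>s\<close> and \<open>\<rho>\<close>. There are only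
  finitely many codebooks, and the decoder is determined by the codebook, so a codebook with the least
  error probability satisfies all these bounds at once, hence also both infima.
\<close>

section \<open>Two inequalities for powers\<close>

text \<open>Each normalised term \<open>g x / G\<close>, where \<open>G\<close> is the total, lies in \<open>[0, 1]\<close>, where raising to the
power \<open>\<theta> \<le> 1\<close> does not decrease; the normalised terms sum to 1.\<close>

lemma powr_sum_le_sum_powr:
  fixes g :: "'a \<Rightarrow> real"
  assumes "finite S" "\<And>x. x \<in> S \<Longrightarrow> g x \<ge> 0" "0 < \<theta>" "\<theta> \<le> 1"
  shows "(\<Sum>x\<in>S. g x) powr \<theta> \<le> (\<Sum>x\<in>S. g x powr \<theta>)"
proof (cases "(\<Sum>x\<in>S. g x) = 0")
  case True
  then show ?thesis by (simp add: sum_nonneg)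
next
  case False
  define G where "G = (\<Sum>x\<in>S. g x)"
  have G: "G > 0"
    using False assms(2) sum_nonneg[of S g] unfolding G_def by fastforce
  have le: "g x / G \<le> (g x / G) powr \<theta>" if "x \<in> S" for x
  proof -
    have "g x \<le> G" unfolding G_def using assms that by (intro member_le_sum) auto
    then have "g x / G \<le> 1" "g x / G \<ge> 0" using G assms(2)[OF that] by auto
    then show ?thesis using powr_mono'[of \<theta> 1 "g x / G"] assms by (simp del: abs_divide)
  qed
  have "1 = (\<Sum>x\<in>S. g x / G)"
    using G by (simp add: sum_divide_distrib[symmetric] G_def[symmetric])
  also have "\<dots> \<le> (\<Sum>x\<in>S. (g x / G) powr \<theta>)" by (intro sum_mono le)
  also have "\<dots> = (\<Sum>x\<in>S. g x powr \<theta>) / G powr \<theta>"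
    using G assms(2) by (simp add: powr_divide sum_divide_distrib)
  finally show ?thesis using G by (simp add: G_def[symmetric] field_simps)
qed

text \<open>Jensen's inequality for the concave function \<open>u \<mapsto> u powr \<rho>\<close>, from its tangent at the mean. The case of
mean 0 is separate: there is no tangent at 0, and the claim stays true for \<open>\<rho> = 0\<close> because of the
convention \<open>0 powr 0 = 0\<close>.\<close>

lemma expectation_powr_le:
  fixes p :: "'a pmf" and u :: "'a \<Rightarrow> real"
  assumes fin: "finite (set_pmf p)" and u: "\<And>x. x \<in> set_pmf p \<Longrightarrow> u x \<ge> 0"
    and \<rho>: "0 \<le> \<rho>" "\<rho> \<le> 1"
  shows "measure_pmf.expectation p (\<lambda>x. u x powr \<rho>) \<le> measure_pmf.expectation p u powr \<rho>"
proof (cases "measure_pmf.expectation p u = 0")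
  case True
  have "u x = 0" if "x \<in> set_pmf p" for x
  proof -
    have "(\<Sum>x\<in>set_pmf p. u x * pmf p x) = 0"
      using True fin by (subst (asm) integral_measure_pmf_real[where A = "set_pmf p"]) auto
    then have "u x * pmf p x = 0"
      using that fin u by (subst (asm) sum_nonneg_eq_0_iff) auto
    then show ?thesis using that by (simp add: set_pmf_iff)
  qed
  then have "measure_pmf.expectation p (\<lambda>x. u x powr \<rho>) = measure_pmf.expectation p (\<lambda>x. 0)"
    by (intro integral_cong_AE) (auto simp: AE_measure_pmf_iff)
  then show ?thesis by simp
next
  case False
  define m where "m = measure_pmf.expectation p u"
  have "m \<ge> 0" unfolding m_def
    by (intro integral_nonneg_AE) (auto simp: AE_measure_pmf_iff u)
  with False have m: "m > 0" by (simp add: m_def)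
  have tangent: "u x powr \<rho> \<le> m powr \<rho> * (\<rho> * (u x / m) + (1 - \<rho>))"
    if "x \<in> set_pmf p" for x
  proof (cases "u x = 0")
    case True
    then show ?thesis using \<rho> by simp
  next
    case False
    then have "u x > 0" using u[OF that] by simp
    then have "(u x / m) powr \<rho> * 1 powr (1 - \<rho>) \<le> \<rho> * (u x / m) + (1 - \<rho>) * 1"
      using m \<rho> by (intro Youngs_inequality_0) auto
    then show ?thesis using m \<open>u x > 0\<close> by (simp add: powr_divide field_simps)
  qed
  have "measure_pmf.expectation p (\<lambda>x. u x powr \<rho>)
      \<le> measure_pmf.expectation p (\<lambda>x. m powr \<rho> * (\<rho> * (u x / m) + (1 - \<rho>)))"
    using fin by (intro integral_mono_AE integrable_measure_pmf_finite)
      (auto simp: AE_measure_pmf_iff intro: tangent simp del: times_divide_eq_right)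
  also have "\<dots> = m powr \<rho> * (\<rho> * (m / m) + (1 - \<rho>))"
    using fin by (simp add: integrable_measure_pmf_finite m_def)
  also have "\<dots> = m powr \<rho>" using m by simp
  finally show ?thesis by (simp add: m_def)
qed

section \<open>Random codebooks\<close>

lemma exists_le_expectation:
  fixes p :: "'a pmf" and F :: "'a \<Rightarrow> real"
  assumes "finite (set_pmf p)" "measure_pmf.expectation p F \<le> b"
  shows "\<exists>c\<in>set_pmf p. F c \<le> b"
proof (rule ccontr)
  assume "\<not> ?thesis"
  then have *: "\<And>c. c \<in> set_pmf p \<Longrightarrow> b < F c" by auto
  have "b = (\<Sum>c\<in>set_pmf p. b * pmf p c)"
    using assms(1) by (simp add: sum_distrib_left[symmetric] sum_pmf_eq_1)
  also have "\<dots> < (\<Sum>c\<in>set_pmf p. F c * pmf p c)"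
    using assms(1) * by (intro sum_strict_mono) (auto simp: set_pmf_not_empty pmf_positive)
  also have "\<dots> = measure_pmf.expectation p F"
    using assms(1) by (subst integral_measure_pmf_real[where A = "set_pmf p"]) auto
  finally show False using assms(2) by simp
qed

lemma finite_set_Pi_pmf:
  assumes "finite I" "finite (set_pmf q)"
  shows "finite (set_pmf (Pi_pmf I d (\<lambda>_. q)))"
  using assms by (auto simp: set_Pi_pmf)

lemma expectation_prod_subset:
  fixes g :: "'a \<Rightarrow> real" and q :: "'a pmf"
  assumes "finite I" "S \<subseteq> I" "finite (set_pmf q)" "\<And>x. g x \<ge> 0"
  shows "measure_pmf.expectation (Pi_pmf I d (\<lambda>_. q)) (\<lambda>c. \<Prod>j\<in>S. g (c j))
       = measure_pmf.expectation q g ^ card S"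
proof -
  have restr: "(\<Prod>i\<in>I. if i \<in> S then h i else 1) = (\<Prod>i\<in>S. h i)" for h :: "'b \<Rightarrow> real"
    using assms(1,2) by (simp add: prod.inter_restrict[symmetric] Int_absorb1)
  have "measure_pmf.expectation (Pi_pmf I d (\<lambda>_. q)) (\<lambda>c. \<Prod>j\<in>S. g (c j))
      = measure_pmf.expectation (Pi_pmf I d (\<lambda>_. q)) (\<lambda>c. \<Prod>i\<in>I. if i \<in> S then g (c i) else 1)"
    by (simp add: restr)
  also have "\<dots> = (\<Prod>i\<in>I. measure_pmf.expectation q (\<lambda>v. if i \<in> S then g v else 1))"
    using assms by (intro expectation_prod_Pi_pmf)
      (auto intro: integrable_measure_pmf_finite)
  also have "\<dots> = (\<Prod>i\<in>I. if i \<in> S then measure_pmf.expectation q g else 1)"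
    by (intro prod.cong) auto
  also have "\<dots> = measure_pmf.expectation q g ^ card S" by (simp add: restr)
  finally show ?thesis .
qed

text \<open>A codeword is independent of the others. The hypothesis on \<open>h\<close> says that it ignores
codeword \<open>i\<close>.\<close>

lemma expectation_mult_remaining:
  fixes g :: "'a \<Rightarrow> real" and q :: "'a pmf" and h :: "('i \<Rightarrow> 'a) \<Rightarrow> real"
  assumes "finite I" "i \<in> I" "finite (set_pmf q)"
    and h: "\<And>c x. h (c(i := x)) = h c"
  shows "measure_pmf.expectation (Pi_pmf I d (\<lambda>_. q)) (\<lambda>c. g (c i) * h c)
       = measure_pmf.expectation q g * measure_pmf.expectation (Pi_pmf (I - {i}) d (\<lambda>_. q)) h"
proof -
  let ?r = "Pi_pmf (I - {i}) d (\<lambda>_. q)"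
  have fin: "finite (set_pmf ?r)" using assms by (intro finite_set_Pi_pmf) auto
  have "Pi_pmf I d (\<lambda>_. q) = Pi_pmf (insert i (I - {i})) d (\<lambda>_. q)"
    using assms(2) by (simp add: insert_absorb)
  also have "\<dots> = q \<bind> (\<lambda>x. map_pmf (\<lambda>c. c(i := x)) ?r)"
    using assms(1) by (subst Pi_pmf_insert') (auto simp: map_pmf_def)
  finally have "measure_pmf.expectation (Pi_pmf I d (\<lambda>_. q)) (\<lambda>c. g (c i) * h c)
      = (\<Sum>x\<in>set_pmf q. pmf q x *\<^sub>R measure_pmf.expectation ?r (\<lambda>c. g x * h c))"
    using assms fin by (simp add: pmf_expectation_bind[where A = "set_pmf q"] h)
  also have "\<dots> = (\<Sum>x\<in>set_pmf q. g x * pmf q x) * measure_pmf.expectation ?r h"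
    by (simp add: sum_distrib_right mult_ac)
  also have "(\<Sum>x\<in>set_pmf q. g x * pmf q x) = measure_pmf.expectation q g"
    using assms by (subst integral_measure_pmf_real[where A = "set_pmf q"]) auto
  finally show ?thesis .
qed

text \<open>Distinct codewords of a random codebook form an i.i.d. tuple, so every statistic of them has the
mean that it has for one fixed index set \<open>K\<close>; the expurgated bound needs a common value for all
groups of \<open>L\<close> codewords.\<close>

lemma expectation_reindexed_codewords:
  fixes q :: "'a pmf" and G :: "('k \<Rightarrow> 'a) \<Rightarrow> real" and h :: "'k \<Rightarrow> 'i"
  assumes "finite I" "finite K" "inj_on h K" "h ` K \<subseteq> I"
    and G: "\<And>x x'. (\<And>k. k \<in> K \<Longrightarrow> x k = x' k) \<Longrightarrow> G x = G x'"
  shows "measure_pmf.expectation (Pi_pmf I d (\<lambda>_. q)) (\<lambda>c. G (\<lambda>k. c (h k)))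
       = measure_pmf.expectation (Pi_pmf K d (\<lambda>_. q)) G"
proof -
  have onto: "Pi_pmf K d (\<lambda>_. q)
      = map_pmf (\<lambda>c k. if k \<in> K then c (h k) else d) (Pi_pmf (h ` K) d (\<lambda>_. q))"
    using assms(2,3)
  proof (induction K rule: finite_induct)
    case empty
    then show ?case by simp
  next
    case (insert k K)
    have upd: "(\<lambda>j. if j = k \<or> j \<in> K then (c(h k := y)) (h j) else d)
        = (\<lambda>j. if j \<in> K then c (h j) else d)(k := y)" for c y
    proof -
      have "h j \<noteq> h k" if "j \<in> K" for j
        using insert.prems insert.hyps that by (auto simp: inj_on_def)
      then show ?thesis using insert.hyps by (auto simp: fun_eq_iff)
    qed
    show ?case
      using insert by (simp add: Pi_pmf_insert' map_bind_pmf bind_map_pmf upd inj_on_insert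
          del: fun_upd_apply)
  qed
  have "Pi_pmf K d (\<lambda>_. q) = map_pmf (\<lambda>c k. if k \<in> K then c (h k) else d) (Pi_pmf I d (\<lambda>_. q))"
    unfolding onto Pi_pmf_subset[OF assms(1,4)]
    by (auto simp: pmf.map_comp fun_eq_iff intro!: pmf.map_cong0)
  then have "measure_pmf.expectation (Pi_pmf K d (\<lambda>_. q)) G
     = measure_pmf.expectation (Pi_pmf I d (\<lambda>_. q)) (\<lambda>c. G (\<lambda>k. if k \<in> K then c (h k) else d))"
    by simp
  also have "\<dots> = measure_pmf.expectation (Pi_pmf I d (\<lambda>_. q)) (\<lambda>c. G (\<lambda>k. c (h k)))"
    by (intro arg_cong[where f = "measure_pmf.expectation _"] ext G) auto
  finally show ?thesis by simp
qed

section \<open>Maximum-likelihood list decoding\<close>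

lemma exists_top_list:
  fixes w :: "'i \<Rightarrow> real"
  assumes "finite I" "l \<le> card I"
  shows "\<exists>D\<subseteq>I. card D = l \<and> (\<forall>j\<in>D. \<forall>i\<in>I - D. w i \<le> w j)"
  using assms(2)
proof (induction l)
  case 0
  then show ?case by (intro exI[of _ "{}"]) auto
next
  case (Suc l)
  then obtain D where D: "D \<subseteq> I" "card D = l" "\<forall>j\<in>D. \<forall>i\<in>I - D. w i \<le> w j" by auto
  have fD: "finite D" using D(1) assms(1) finite_subset by blast
  have ne: "I - D \<noteq> {}"
    using Suc.prems D assms(1) fD card_mono[of D I] by auto
  define m where "m = Max (w ` (I - D))"
  have "m \<in> w ` (I - D)" unfolding m_def using assms(1) ne by (intro Max_in) auto
  then obtain k where k: "k \<in> I - D" "w k = m" by auto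
  have "w i \<le> w k" if "i \<in> I - D" for i
    unfolding k(2) m_def using assms(1) that by (intro Max_ge) auto
  then show ?case
    using D k fD by (intro exI[of _ "insert k D"]) auto
qed

definition top_list :: "nat \<Rightarrow> 'i set \<Rightarrow> ('i \<Rightarrow> real) \<Rightarrow> 'i set" where
  "top_list l I w = (SOME D. D \<subseteq> I \<and> card D = l \<and> (\<forall>j\<in>D. \<forall>i\<in>I - D. w i \<le> w j))"

lemma top_list:
  assumes "finite I" "l \<le> card I"
  shows "top_list l I w \<subseteq> I" "card (top_list l I w) = l"
    "\<And>j i. j \<in> top_list l I w \<Longrightarrow> i \<in> I - top_list l I w \<Longrightarrow> w i \<le> w j"
proof -
  have "top_list l I w \<subseteq> I \<and> card (top_list l I w) = l
      \<and> (\<forall>j\<in>top_list l I w. \<forall>i\<in>I - top_list l I w. w i \<le> w j)"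
    unfolding top_list_def using exists_top_list[OF assms, of w] by (rule someI_ex)
  then show "top_list l I w \<subseteq> I" "card (top_list l I w) = l"
    "\<And>j i. j \<in> top_list l I w \<Longrightarrow> i \<in> I - top_list l I w \<Longrightarrow> w i \<le> w j" by auto
qed

text \<open>
  The channel and the codewords are abstract here: \<open>V x\<close> is the output distribution for the whole
  codeword \<open>x\<close>, and the product structure of a memoryless channel enters only later.\<close>

definition ml_error :: "('a \<Rightarrow> 'b pmf) \<Rightarrow> nat \<Rightarrow> 'i set \<Rightarrow> ('i \<Rightarrow> 'a) \<Rightarrow> 'i \<Rightarrow> real" where
  "ml_error V l I c i =
     measure_pmf.prob (V (c i)) {y. i \<notin> top_list l I (\<lambda>j. pmf (V (c j)) y)}"

text \<open>The groups of \<open>l\<close> other codewords that together can push \<open>i\<close> off a list of length \<open>l\<close>.\<close>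

definition rivals :: "nat \<Rightarrow> 'i set \<Rightarrow> 'i \<Rightarrow> 'i set set" where
  "rivals l I i = {S. S \<subseteq> I - {i} \<and> card S = l}"

lemma finite_rivals: "finite I \<Longrightarrow> finite (rivals l I i)"
  unfolding rivals_def by (rule finite_subset[of _ "Pow I"]) auto

lemma card_rivals:
  assumes "finite I" "i \<in> I"
  shows "card (rivals l I i) = (card I - 1) choose l"
  using assms unfolding rivals_def by (simp add: n_subsets)

lemma card_rivals_le:
  assumes "finite I" "i \<in> I"
  shows "real (card (rivals l I i)) \<le> real (card I) ^ l"
proof -
  have "(card I - 1) choose l \<le> (card I - 1) ^ l"
    by (cases "l \<le> card I - 1") (auto simp: binomial_eq_0 intro: binomial_le_pow)
  also have "\<dots> \<le> card I ^ l" by (intro power_mono) auto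
  finally show ?thesis
    using assms by (simp add: card_rivals flip: of_nat_power)
qed

lemma rivalsD: "finite I \<Longrightarrow> S \<in> rivals l I i \<Longrightarrow> finite S \<and> i \<notin> S \<and> S \<subseteq> I \<and> card S = l"
  unfolding rivals_def using finite_subset by fastforce

lemma rival_of_ml_error:
  assumes "finite I" "l \<le> card I" "i \<in> I" "i \<notin> top_list l I w"
  shows "\<exists>S\<in>rivals l I i. \<forall>j\<in>S. w i \<le> w j"
  using top_list[OF assms(1,2), where w = w] assms(3,4)
  by (intro bexI[of _ "top_list l I w"]) (auto simp: rivals_def)

lemma ml_error_eq_sum:
  assumes "finite B" "set_pmf (V (c i)) \<subseteq> B"
  shows "ml_error V l I c i
       = (\<Sum>y\<in>B. if i \<notin> top_list l I (\<lambda>j. pmf (V (c j)) y) then pmf (V (c i)) y else 0)"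
proof -
  let ?E = "{y. i \<notin> top_list l I (\<lambda>j. pmf (V (c j)) y)}"
  have "ml_error V l I c i = measure_pmf.prob (V (c i)) (?E \<inter> B)"
    unfolding ml_error_def
    using assms(2) measure_Int_set_pmf[of "V (c i)" ?E] measure_Int_set_pmf[of "V (c i)" "?E \<inter> B"]
    by (simp add: Int_assoc Int_absorb1)
  also have "\<dots> = (\<Sum>y\<in>?E \<inter> B. pmf (V (c i)) y)"
    using assms by (intro measure_measure_pmf_finite) auto
  also have "\<dots> = (\<Sum>y\<in>B. if y \<in> ?E then pmf (V (c i)) y else 0)"
    using assms by (simp add: sum.inter_restrict Int_commute)
  finally show ?thesis by simp
qed

text \<open>The rivals on the list are all at least as likely as \<open>i\<close>, so the sum of products is at least
\<open>w i powr (l * \<tau>)\<close>. The exponent \<open>\<tau>\<close> is the one for which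
\<open>\<tau> + l * \<tau> * \<rho> = 1\<close>, so that the right-hand side collapses to \<open>w i\<close>. It is also the exponent
for which codeword \<open>i\<close> and its rivals carry the same power, hence the same mean when the codebook
is random.\<close>

lemma error_weight_le_tilted:
  fixes w :: "'i \<Rightarrow> real"
  assumes I: "finite I" "l \<le> card I" "i \<in> I" and w: "\<And>j. w j \<ge> 0"
    and \<rho>: "0 \<le> \<rho>" and err: "i \<notin> top_list l I w"
  defines "\<tau> \<equiv> 1 / (1 + real l * \<rho>)"
  shows "w i \<le> w i powr \<tau> * (\<Sum>S\<in>rivals l I i. \<Prod>j\<in>S. w j powr \<tau>) powr \<rho>"
proof (cases "w i = 0")
  case True
  then show ?thesis by simp
next
  case False
  then have wi: "w i > 0" using w[of i] by simp
  obtain S where S: "S \<in> rivals l I i" "\<forall>j\<in>S. w i \<le> w j"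
    using rival_of_ml_error[OF I err] by blast
  have pos: "1 + real l * \<rho> > 0" using \<rho> by (simp add: add_pos_nonneg)
  have \<tau>: "\<tau> \<ge> 0" "\<tau> + real l * \<tau> * \<rho> = 1"
    using pos unfolding \<tau>_def by (auto simp: field_simps)
  have "w i powr (real l * \<tau>) = (\<Prod>j\<in>S. w i powr \<tau>)"
    using wi rivalsD[OF I(1) S(1)] by (simp add: powr_power mult.commute)
  also have "\<dots> \<le> (\<Prod>j\<in>S. w j powr \<tau>)"
    using S w \<tau> by (intro prod_mono) (auto intro!: powr_mono2)
  also have "\<dots> \<le> (\<Sum>S\<in>rivals l I i. \<Prod>j\<in>S. w j powr \<tau>)"
    using S(1) finite_rivals[OF I(1)] by (intro member_le_sum) (auto intro: prod_nonneg)
  finally have "(w i powr (real l * \<tau>)) powr \<rho> \<le> (\<Sum>S\<in>rivals l I i. \<Prod>j\<in>S. w j powr \<tau>) powr \<rho>"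
    using \<rho> by (intro powr_mono2) auto
  then have "w i powr \<tau> * w i powr (real l * \<tau> * \<rho>)
      \<le> w i powr \<tau> * (\<Sum>S\<in>rivals l I i. \<Prod>j\<in>S. w j powr \<tau>) powr \<rho>"
    by (intro mult_left_mono) (auto simp: powr_powr)
  moreover have "w i powr \<tau> * w i powr (real l * \<tau> * \<rho>) = w i"
    using wi \<tau>(2) by (simp add: powr_add[symmetric])
  ultimately show ?thesis by simp
qed

text \<open>The rivals on the list are all at least as likely as \<open>i\<close>, so \<open>w i\<close> is at most the geometric mean
of the \<open>l + 1\<close> weights involved.\<close>

lemma error_weight_le_bhattacharyya:
  fixes w :: "'i \<Rightarrow> real"
  assumes I: "finite I" "l \<le> card I" "i \<in> I" and w: "\<And>j. w j \<ge> 0"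
    and err: "i \<notin> top_list l I w"
  shows "w i \<le> (\<Sum>S\<in>rivals l I i. \<Prod>j\<in>insert i S. w j powr (1 / real (Suc l)))"
proof -
  obtain S where S: "S \<in> rivals l I i" "\<forall>j\<in>S. w i \<le> w j"
    using rival_of_ml_error[OF I err] by blast
  note fS = rivalsD[OF I(1) S(1)]
  have "w i = (\<Prod>j\<in>insert i S. w i powr (1 / real (Suc l)))"
  proof (cases "w i = 0")
    case False
    then have "w i > 0" using w[of i] by simp
    moreover have "card (insert i S) = Suc l" using fS by simp
    ultimately show ?thesis by (simp only: prod_constant powr_power) simp
  qed (use fS in simp)
  also have "\<dots> \<le> (\<Prod>j\<in>insert i S. w j powr (1 / real (Suc l)))"
    using S w by (intro prod_mono) (auto intro!: powr_mono2)
  also have "\<dots> \<le> (\<Sum>S\<in>rivals l I i. \<Prod>j\<in>insert i S. w j powr (1 / real (Suc l)))"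
    using S(1) finite_rivals[OF I(1)] by (intro member_le_sum) (auto intro: prod_nonneg)
  finally show ?thesis .
qed

section \<open>The random coding bound for one use of an abstract channel\<close>

lemma expected_rivals_powr_le:
  fixes q :: "'a pmf" and g :: "'a \<Rightarrow> real"
  assumes I: "finite I" "i \<in> I" and q: "finite (set_pmf q)" and g: "\<And>x. g x \<ge> 0"
    and \<rho>: "0 \<le> \<rho>" "\<rho> \<le> 1"
  shows "measure_pmf.expectation (Pi_pmf (I - {i}) d (\<lambda>_. q))
           (\<lambda>c. (\<Sum>S\<in>rivals l I i. \<Prod>j\<in>S. g (c j)) powr \<rho>)
       \<le> (real (card I) ^ l * measure_pmf.expectation q g ^ l) powr \<rho>"
proof -
  let ?r = "Pi_pmf (I - {i}) d (\<lambda>_. q)" and ?m = "measure_pmf.expectation q g"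
  have fin: "finite (set_pmf ?r)" using I q by (intro finite_set_Pi_pmf) auto
  have m: "?m \<ge> 0" using g by simp
  have nonneg: "(\<Sum>S\<in>rivals l I i. \<Prod>j\<in>S. g (c j)) \<ge> 0" for c
    using g by (intro sum_nonneg prod_nonneg) auto
  have "measure_pmf.expectation ?r (\<lambda>c. \<Sum>S\<in>rivals l I i. \<Prod>j\<in>S. g (c j))
      = (\<Sum>S\<in>rivals l I i. measure_pmf.expectation ?r (\<lambda>c. \<Prod>j\<in>S. g (c j)))"
    using fin by (intro Bochner_Integration.integral_sum integrable_measure_pmf_finite)
  also have "\<dots> = (\<Sum>S\<in>rivals l I i. ?m ^ l)"
  proof (intro sum.cong refl)
    fix S assume "S \<in> rivals l I i"
    then have "S \<subseteq> I - {i}" "card S = l" by (auto simp: rivals_def)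
    then show "measure_pmf.expectation ?r (\<lambda>c. \<Prod>j\<in>S. g (c j)) = ?m ^ l"
      using I q g by (subst expectation_prod_subset) auto
  qed
  also have "\<dots> \<le> real (card I) ^ l * ?m ^ l"
    using card_rivals_le[OF I, of l] m by (simp add: mult_right_mono)
  finally have mean: "measure_pmf.expectation ?r (\<lambda>c. \<Sum>S\<in>rivals l I i. \<Prod>j\<in>S. g (c j))
      \<le> real (card I) ^ l * ?m ^ l" .
  have "measure_pmf.expectation ?r (\<lambda>c. (\<Sum>S\<in>rivals l I i. \<Prod>j\<in>S. g (c j)) powr \<rho>)
      \<le> measure_pmf.expectation ?r (\<lambda>c. \<Sum>S\<in>rivals l I i. \<Prod>j\<in>S. g (c j)) powr \<rho>"
    using fin nonneg \<rho> by (intro expectation_powr_le) auto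
  also have "\<dots> \<le> (real (card I) ^ l * ?m ^ l) powr \<rho>"
    using mean \<rho> nonneg by (intro powr_mono2) auto
  finally show ?thesis .
qed

text \<open>Codeword \<open>i\<close> is independent of its rivals, so the mean of the bound of
\<open>error_weight_le_tilted\<close> is a product: with \<open>m\<close> the mean of the tilted likelihood, the codeword
contributes \<open>m\<close> and, by Jensen, the rivals contribute at most the power \<open>\<rho>\<close> of
\<open>card I ^ l * m ^ l\<close>. Together the exponent of \<open>m\<close> is \<open>1 + l * \<rho>\<close>. Some codebook is
no worse than the mean.\<close>

lemma random_coding_one_shot:
  fixes V :: "'a \<Rightarrow> 'b pmf" and q :: "'a pmf"
  assumes I: "finite I" "l \<le> card I" "l > 0" and q: "finite (set_pmf q)"
    and B: "finite B" "\<And>x. x \<in> set_pmf q \<Longrightarrow> set_pmf (V x) \<subseteq> B"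
    and \<rho>: "0 \<le> \<rho>" "\<rho> \<le> 1"
  defines "a \<equiv> 1 + real l * \<rho>"
  shows "\<exists>c\<in>I \<rightarrow>\<^sub>E set_pmf q.
     (\<Sum>i\<in>I. ml_error V l I c i) / real (card I)
       \<le> real (card I) powr (real l * \<rho>)
         * (\<Sum>y\<in>B. measure_pmf.expectation q (\<lambda>x. pmf (V x) y powr (1 / a)) powr a)"
proof -
  let ?p = "Pi_pmf I undefined (\<lambda>_. q)"
  define g where "g = (\<lambda>y x. pmf (V x) y powr (1 / a))"
  define u where "u = (\<lambda>y i c. (\<Sum>S\<in>rivals l I i. \<Prod>j\<in>S. g y (c j)) powr \<rho>)"
  have fin: "finite (set_pmf ?p)" using I q by (intro finite_set_Pi_pmf) auto
  have int [simp]: "integrable (measure_pmf ?p) h" for h :: "_ \<Rightarrow> real"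
    using fin by (rule integrable_measure_pmf_finite)
  have supp: "set_pmf (V (c i)) \<subseteq> B" if "c \<in> set_pmf ?p" "i \<in> I" for c i
    using that I by (intro B(2)) (auto simp: set_Pi_pmf PiE_dflt_def)
  have err: "ml_error V l I c i \<le> (\<Sum>y\<in>B. g y (c i) * u y i c)"
    if c: "c \<in> set_pmf ?p" and i: "i \<in> I" for c i
    unfolding ml_error_eq_sum[where V = V and c = c and i = i, OF B(1) supp[OF c i]]
  proof (rule sum_mono)
    fix y
    show "(if i \<notin> top_list l I (\<lambda>j. pmf (V (c j)) y) then pmf (V (c i)) y else 0)
        \<le> g y (c i) * u y i c"
      using error_weight_le_tilted[OF I(1,2) i, of "\<lambda>j. pmf (V (c j)) y" \<rho>] \<rho>
      by (auto simp: g_def u_def a_def)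
  qed
  have one: "measure_pmf.expectation ?p (\<lambda>c. g y (c i) * u y i c)
      \<le> real (card I) powr (real l * \<rho>) * measure_pmf.expectation q (g y) powr a"
    if i: "i \<in> I" for i y
  proof -
    let ?m = "measure_pmf.expectation q (g y)"
    have m: "?m \<ge> 0" by (simp add: g_def)
    have "u y i (c(i := x)) = u y i c" for c x
    proof -
      have "(\<Prod>j\<in>S. g y ((c(i := x)) j)) = (\<Prod>j\<in>S. g y (c j))" if "S \<in> rivals l I i" for S
        using rivalsD[OF I(1) that] by (intro prod.cong) auto
      then show ?thesis by (simp add: u_def)
    qed
    then have "measure_pmf.expectation ?p (\<lambda>c. g y (c i) * u y i c)
        = ?m * measure_pmf.expectation (Pi_pmf (I - {i}) undefined (\<lambda>_. q)) (u y i)"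
      using I i q by (intro expectation_mult_remaining) auto
    also have "\<dots> \<le> ?m * (real (card I) ^ l * ?m ^ l) powr \<rho>"
      unfolding u_def using I i q \<rho> m
      by (intro mult_left_mono expected_rivals_powr_le) (auto simp: g_def)
    also have "\<dots> = real (card I) powr (real l * \<rho>) * (?m powr 1 * ?m powr (real l * \<rho>))"
      using m I(3) by (simp add: powr_mult powr_powr flip: powr_realpow')
    also have "?m powr 1 * ?m powr (real l * \<rho>) = ?m powr a"
      by (simp add: a_def powr_add)
    finally show ?thesis .
  qed
  have "measure_pmf.expectation ?p (\<lambda>c. \<Sum>i\<in>I. ml_error V l I c i)
      \<le> measure_pmf.expectation ?p (\<lambda>c. \<Sum>i\<in>I. \<Sum>y\<in>B. g y (c i) * u y i c)"
    by (intro integral_mono_AE) (auto simp: AE_measure_pmf_iff intro!: sum_mono err)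
  also have "\<dots> = (\<Sum>i\<in>I. \<Sum>y\<in>B. measure_pmf.expectation ?p (\<lambda>c. g y (c i) * u y i c))"
    by (subst Bochner_Integration.integral_sum, simp)+ simp
  also have "\<dots> \<le> (\<Sum>i\<in>I. \<Sum>y\<in>B. real (card I) powr (real l * \<rho>) * measure_pmf.expectation q (g y) powr a)"
    by (intro sum_mono one)
  also have "\<dots> = (real (card I) powr (real l * \<rho>) * (\<Sum>y\<in>B. measure_pmf.expectation q (g y) powr a)) * real (card I)"
    by (simp add: sum_distrib_left mult_ac)
  finally obtain c where "c \<in> set_pmf ?p" "(\<Sum>i\<in>I. ml_error V l I c i)
      \<le> (real (card I) powr (real l * \<rho>) * (\<Sum>y\<in>B. measure_pmf.expectation q (g y) powr a)) * real (card I)"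
    using exists_le_expectation[OF fin] by blast
  moreover have "set_pmf ?p = I \<rightarrow>\<^sub>E set_pmf q"
    using I by (auto simp: set_Pi_pmf PiE_dflt_def PiE_def extensional_def)
  moreover have "card I > 0" using I by linarith
  ultimately show ?thesis
    by (intro bexI[of _ c]) (auto simp: g_def divide_le_eq)
qed

section \<open>Expurgation for one use of an abstract channel\<close>

text \<open>The Bhattacharyya coefficient of the codewords indexed by \<open>S\<close>, raised to the power \<open>1 / \<rho>\<close>: this
power, and not the coefficient itself, is averaged over the codebook.\<close>

definition bhattacharyya :: "('a \<Rightarrow> 'b pmf) \<Rightarrow> 'b set \<Rightarrow> real \<Rightarrow> 'i set \<Rightarrow> ('i \<Rightarrow> 'a) \<Rightarrow> real" where
  "bhattacharyya V B \<rho> S c =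
     (\<Sum>y\<in>B. \<Prod>j\<in>S. pmf (V (c j)) y powr (1 / real (card S))) powr (1 / \<rho>)"

lemma bhattacharyya_nonneg: "bhattacharyya V B \<rho> S c \<ge> 0"
  by (simp add: bhattacharyya_def)

lemma bhattacharyya_cong:
  "(\<And>j. j \<in> S \<Longrightarrow> c j = c' j) \<Longrightarrow> bhattacharyya V B \<rho> S c = bhattacharyya V B \<rho> S c'"
  unfolding bhattacharyya_def by (intro arg_cong2[where f = "(powr)"] sum.cong prod.cong) auto

lemma bhattacharyya_image:
  assumes "inj_on h S"
  shows "bhattacharyya V B \<rho> (h ` S) c = bhattacharyya V B \<rho> S (\<lambda>k. c (h k))"
  using assms unfolding bhattacharyya_def by (simp add: card_image prod.reindex)

lemma ml_error_le_bhattacharyya: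
  assumes I: "finite I" "l \<le> card I" "i \<in> I" and B: "finite B" "set_pmf (V (c i)) \<subseteq> B"
    and \<rho>: "1 \<le> \<rho>"
  shows "ml_error V l I c i \<le> (\<Sum>S\<in>rivals l I i. bhattacharyya V B \<rho> (insert i S) c) powr \<rho>"
proof -
  define h where "h = (\<lambda>S. \<Sum>y\<in>B. \<Prod>j\<in>insert i S. pmf (V (c j)) y powr (1 / real (Suc l)))"
  have h: "h S \<ge> 0" for S unfolding h_def by (intro sum_nonneg prod_nonneg) auto
  have hb: "h S powr (1 / \<rho>) = bhattacharyya V B \<rho> (insert i S) c" if "S \<in> rivals l I i" for S
    using rivalsD[OF I(1) that] by (simp add: bhattacharyya_def h_def)
  have "ml_error V l I c i \<le> (\<Sum>y\<in>B. \<Sum>S\<in>rivals l I i. \<Prod>j\<in>insert i S. pmf (V (c j)) y powr (1 / real (Suc l)))"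
    unfolding ml_error_eq_sum[where V = V and c = c and i = i, OF B]
  proof (rule sum_mono)
    fix y
    have "0 \<le> (\<Sum>S\<in>rivals l I i. \<Prod>j\<in>insert i S. pmf (V (c j)) y powr (1 / real (Suc l)))"
      by (intro sum_nonneg prod_nonneg) auto
    then show "(if i \<notin> top_list l I (\<lambda>j. pmf (V (c j)) y) then pmf (V (c i)) y else 0)
        \<le> (\<Sum>S\<in>rivals l I i. \<Prod>j\<in>insert i S. pmf (V (c j)) y powr (1 / real (Suc l)))"
      using error_weight_le_bhattacharyya[OF I, of "\<lambda>j. pmf (V (c j)) y"] by auto
  qed
  also have "\<dots> = (\<Sum>S\<in>rivals l I i. h S)"
    unfolding h_def by (rule sum.swap)
  also have "\<dots> = ((\<Sum>S\<in>rivals l I i. h S) powr (1 / \<rho>)) powr \<rho>"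
    using \<rho> h by (simp add: powr_powr sum_nonneg)
  also have "\<dots> \<le> (\<Sum>S\<in>rivals l I i. h S powr (1 / \<rho>)) powr \<rho>"
    using \<rho> h finite_rivals[OF I(1)] by (intro powr_mono2 powr_sum_le_sum_powr) auto
  finally show ?thesis by (simp add: hb)
qed

lemma sum_rivals_reindex_le:
  assumes e: "bij_betw e I J" and J: "J \<subseteq> I'" "finite I'" and i: "i \<in> I"
  shows "(\<Sum>S\<in>rivals l I i. bhattacharyya V B \<rho> (insert i S) (\<lambda>k. c (e k)))
       \<le> (\<Sum>S\<in>rivals l I' (e i). bhattacharyya V B \<rho> (insert (e i) S) c)"
proof -
  have inj: "inj_on e I" and im: "e ` I = J" using e by (auto simp: bij_betw_def)
  have sub: "S \<subseteq> I" if "S \<in> rivals l I i" for S using that by (auto simp: rivals_def)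
  have "(\<Sum>S\<in>rivals l I i. bhattacharyya V B \<rho> (insert i S) (\<lambda>k. c (e k)))
      = (\<Sum>S\<in>rivals l I i. bhattacharyya V B \<rho> (insert (e i) (e ` S)) c)"
  proof (intro sum.cong refl)
    fix S assume "S \<in> rivals l I i"
    then have "insert i S \<subseteq> I" using sub i by blast
    then have "inj_on e (insert i S)" using inj inj_on_subset by blast
    from bhattacharyya_image[OF this, of V B \<rho> c]
    show "bhattacharyya V B \<rho> (insert i S) (\<lambda>k. c (e k)) = bhattacharyya V B \<rho> (insert (e i) (e ` S)) c"
      by simp
  qed
  also have "\<dots> = (\<Sum>S\<in>(`) e ` rivals l I i. bhattacharyya V B \<rho> (insert (e i) S) c)"
  proof (subst sum.reindex)
    show "inj_on ((`) e) (rivals l I i)"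
      using inj_on_image_Pow[OF inj] sub by (auto intro: inj_on_subset)
  qed simp
  also have "\<dots> \<le> (\<Sum>S\<in>rivals l I' (e i). bhattacharyya V B \<rho> (insert (e i) S) c)"
  proof (intro sum_mono2 finite_rivals J(2) subsetI)
    fix T assume "T \<in> (`) e ` rivals l I i"
    then obtain S where S: "S \<subseteq> I - {i}" "card S = l" "T = e ` S" by (auto simp: rivals_def)
    have "e ` S \<subseteq> J - {e i}" using S(1) inj im i by (auto simp: inj_on_def)
    moreover have "card (e ` S) = l" using S inj by (metis Diff_subset card_image inj_on_subset subset_trans)
    ultimately show "T \<in> rivals l I' (e i)" using J S by (auto simp: rivals_def)
  qed (rule bhattacharyya_nonneg)
  finally show ?thesis .
qed

text \<open>Markov's inequality for the counting measure on \<open>I\<close>: fewer than half of the indices exceed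
twice a bound on the mean.\<close>

lemma card_le_twice_mean:
  fixes T :: "'i \<Rightarrow> real"
  assumes "finite I" "card I = 2 * M - 1" "M \<ge> 1" and T: "\<And>i. i \<in> I \<Longrightarrow> T i \<ge> 0"
    and le: "(\<Sum>i\<in>I. T i) \<le> real (card I) * b" and b: "b \<ge> 0"
  shows "M \<le> card {i\<in>I. T i \<le> 2 * b}"
proof (rule ccontr)
  let ?G = "{i\<in>I. T i \<le> 2 * b}"
  assume "\<not> M \<le> card ?G"
  moreover have "card (I - ?G) = card I - card ?G"
    using assms(1) by (intro card_Diff_subset) auto
  ultimately have bad: "M \<le> card (I - ?G)" using assms(2,3) by linarith
  then have "card (I - ?G) \<noteq> 0" using assms(3) by linarith
  then have "I - ?G \<noteq> {}" by (metis card.empty)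
  have "real (card I) * b \<le> real M * (2 * b)"
    using assms(2,3) b mult_right_mono[of "real (card I)" "real M * 2" b] by (simp add: mult_ac)
  also have "\<dots> \<le> real (card (I - ?G)) * (2 * b)"
    using bad b by (intro mult_right_mono) auto
  also have "\<dots> = (\<Sum>i\<in>I - ?G. 2 * b)" by simp
  also have "\<dots> < (\<Sum>i\<in>I - ?G. T i)"
    using \<open>I - ?G \<noteq> {}\<close> assms(1) by (intro sum_strict_mono) auto
  also have "\<dots> \<le> (\<Sum>i\<in>I. T i)"
    using assms(1) T by (intro sum_mono2) auto
  finally show False using le by simp
qed

text \<open>Draw \<open>2 * M - 1\<close> codewords and fix a codebook for which the sum of the bounds on
\<open>ml_error powr (1 / \<rho>)\<close> is at most its mean. Keep \<open>M\<close> codewords whose bound is at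
most \<open>2 * b\<close>, where \<open>b\<close> is the estimate of the mean per codeword, and renumber them by \<open>e\<close>.
Deleting codewords only removes rivals, so the bounds persist. Of the factors 2 in the claim, the
outer one is the threshold and the one in \<open>(2 * real M) ^ l\<close> comes from counting the rivals in
the larger codebook.\<close>

lemma expurgated_one_shot:
  fixes V :: "'a \<Rightarrow> 'b pmf" and q :: "'a pmf"
  assumes M: "l \<le> M" "l > 0" and q: "finite (set_pmf q)"
    and B: "finite B" "\<And>x. x \<in> set_pmf q \<Longrightarrow> set_pmf (V x) \<subseteq> B"
    and \<rho>: "1 \<le> \<rho>"
  shows "\<exists>c\<in>{1..M} \<rightarrow>\<^sub>E set_pmf q. \<forall>i\<in>{1..M}. ml_error V l {1..M} c i
      \<le> (2 * ((2 * real M) ^ l * measure_pmf.expectation (Pi_pmf {..<Suc l} d (\<lambda>_. q))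
              (bhattacharyya V B \<rho> {..<Suc l}))) powr \<rho>"
proof -
  define I where "I = {1..2 * M - 1}"
  define K where "K = measure_pmf.expectation (Pi_pmf {..<Suc l} d (\<lambda>_. q))
              (bhattacharyya V B \<rho> {..<Suc l})"
  define T where "T = (\<lambda>c i. \<Sum>S\<in>rivals l I i. bhattacharyya V B \<rho> (insert i S) c)"
  define b where "b = (2 * real M) ^ l * K"
  let ?p = "Pi_pmf I d (\<lambda>_. q)"
  have fI: "finite I" and cI: "card I = 2 * M - 1" by (auto simp: I_def)
  have fin: "finite (set_pmf ?p)" using fI q by (intro finite_set_Pi_pmf) auto
  have int [simp]: "integrable (measure_pmf ?p) h" for h :: "_ \<Rightarrow> real"
    using fin by (rule integrable_measure_pmf_finite)
  have K: "K \<ge> 0" by (simp add: K_def bhattacharyya_nonneg)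
  have b: "b \<ge> 0" using K by (simp add: b_def)
  have K_eq: "measure_pmf.expectation ?p (bhattacharyya V B \<rho> S) = K"
    if S: "S \<subseteq> I" "card S = Suc l" for S
  proof -
    have "finite S" using S fI finite_subset by blast
    then obtain h where "bij_betw h {0..<Suc l} S"
      using ex_bij_betw_nat_finite S(2) by metis
    then have h: "inj_on h {..<Suc l}" "h ` {..<Suc l} = S"
      by (auto simp: bij_betw_def atLeast0LessThan)
    have "bhattacharyya V B \<rho> S = (\<lambda>c. bhattacharyya V B \<rho> {..<Suc l} (\<lambda>k. c (h k)))"
      using bhattacharyya_image[OF h(1), of V B \<rho>] unfolding h(2) by (rule ext)
    moreover have "measure_pmf.expectation ?p (\<lambda>c. bhattacharyya V B \<rho> {..<Suc l} (\<lambda>k. c (h k))) = K"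
      unfolding K_def using h S(1) fI
      by (intro expectation_reindexed_codewords) (auto intro: bhattacharyya_cong)
    ultimately show ?thesis by simp
  qed
  have mean: "measure_pmf.expectation ?p (\<lambda>c. T c i) \<le> b" if i: "i \<in> I" for i
  proof -
    have "measure_pmf.expectation ?p (\<lambda>c. T c i)
        = (\<Sum>S\<in>rivals l I i. measure_pmf.expectation ?p (bhattacharyya V B \<rho> (insert i S)))"
      unfolding T_def by (subst Bochner_Integration.integral_sum) auto
    also have "\<dots> = (\<Sum>S\<in>rivals l I i. K)"
    proof (intro sum.cong refl K_eq)
      fix S assume "S \<in> rivals l I i"
      then show "insert i S \<subseteq> I" "card (insert i S) = Suc l"
        using i rivalsD[OF fI, of S l i] by auto
    qed
    also have "\<dots> \<le> real (card I) ^ l * K"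
      using card_rivals_le[OF fI i] K by (simp add: mult_right_mono)
    also have "\<dots> \<le> b"
      unfolding b_def cI using K by (intro mult_right_mono power_mono) auto
    finally show ?thesis .
  qed
  have "measure_pmf.expectation ?p (\<lambda>c. \<Sum>i\<in>I. T c i) \<le> real (card I) * b"
    using sum_bounded_above[of I "\<lambda>i. measure_pmf.expectation ?p (\<lambda>c. T c i)" b] mean
    by (subst Bochner_Integration.integral_sum) auto
  then obtain c where c: "c \<in> set_pmf ?p" "(\<Sum>i\<in>I. T c i) \<le> real (card I) * b"
    using exists_le_expectation[OF fin] by blast
  have "M \<le> card {i\<in>I. T c i \<le> 2 * b}"
    using fI cI M c(2) b by (intro card_le_twice_mean) (auto simp: T_def sum_nonneg bhattacharyya_nonneg)
  then obtain J where J: "J \<subseteq> {i\<in>I. T c i \<le> 2 * b}" "card J = M" "finite J"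
    by (rule obtain_subset_with_card_n)
  then obtain e where e: "bij_betw e {1..M} J"
    using ex_bij_betw_nat_finite_1 by metis
  define c' where "c' = restrict (\<lambda>k. c (e k)) {1..M}"
  have eJ: "e i \<in> J" if "i \<in> {1..M}" for i using e that by (auto simp: bij_betw_def)
  have c': "c' i \<in> set_pmf q" if "i \<in> {1..M}" for i
    using that eJ[OF that] J(1) c(1) fI by (auto simp: c'_def set_Pi_pmf PiE_dflt_def)
  show ?thesis
  proof (intro bexI[of _ c'] ballI)
    show "c' \<in> {1..M} \<rightarrow>\<^sub>E set_pmf q" using c' by (auto simp: c'_def)
    fix i assume i: "i \<in> {1..M}"
    have "ml_error V l {1..M} c' i
        \<le> (\<Sum>S\<in>rivals l {1..M} i. bhattacharyya V B \<rho> (insert i S) c') powr \<rho>"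
      using i M B c'[OF i] \<rho> by (intro ml_error_le_bhattacharyya) auto
    also have "(\<Sum>S\<in>rivals l {1..M} i. bhattacharyya V B \<rho> (insert i S) c')
        = (\<Sum>S\<in>rivals l {1..M} i. bhattacharyya V B \<rho> (insert i S) (\<lambda>k. c (e k)))"
      using i by (intro sum.cong refl bhattacharyya_cong) (auto simp: c'_def rivals_def)
    also have "\<dots> powr \<rho> \<le> (2 * b) powr \<rho>"
    proof (rule powr_mono2)
      have "(\<Sum>S\<in>rivals l {1..M} i. bhattacharyya V B \<rho> (insert i S) (\<lambda>k. c (e k))) \<le> T c (e i)"
        unfolding T_def using e J fI i by (intro sum_rivals_reindex_le) auto
      also have "\<dots> \<le> 2 * b" using eJ[OF i] J(1) by auto
      finally show "(\<Sum>S\<in>rivals l {1..M} i. bhattacharyya V B \<rho> (insert i S) (\<lambda>k. c (e k))) \<le> 2 * b" .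
    qed (use \<rho> in \<open>auto intro: sum_nonneg bhattacharyya_nonneg\<close>)
    finally show "ml_error V l {1..M} c' i
      \<le> (2 * ((2 * real M) ^ l * measure_pmf.expectation (Pi_pmf {..<Suc l} d (\<lambda>_. q))
              (bhattacharyya V B \<rho> {..<Suc l}))) powr \<rho>"
      by (simp add: b_def K_def)
  qed
qed

section \<open>Words and the constraint shell\<close>

lemma finite_words: "finite (words n :: (nat \<Rightarrow> 'a::finite) set)"
  unfolding words_def by (intro finite_PiE) auto

lemma sum_words_prod:
  fixes g :: "nat \<Rightarrow> 'a::finite \<Rightarrow> real"
  shows "(\<Sum>x\<in>words n. \<Prod>i<n. g i (x i)) = (\<Prod>i<n. \<Sum>a\<in>UNIV. g i a)"
  unfolding words_def by (subst prod_sum_PiE) auto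

text \<open>Arrays given by \<open>L\<close> rows of length \<open>n\<close> are also arrays of \<open>n\<close> columns of height \<open>L\<close>; the
latter can be summed column by column.\<close>

lemma sum_arrays_prod_columns:
  fixes \<gamma> :: "(nat \<Rightarrow> 'a::finite) \<Rightarrow> real"
  shows "(\<Sum>x\<in>{..<L} \<rightarrow>\<^sub>E words n. \<Prod>j<n. \<gamma> (\<lambda>k\<in>{..<L}. x k j))
       = (\<Sum>z\<in>words L. \<gamma> z) ^ n"
proof -
  define tr :: "nat \<Rightarrow> nat \<Rightarrow> (nat \<Rightarrow> nat \<Rightarrow> 'a) \<Rightarrow> nat \<Rightarrow> nat \<Rightarrow> 'a"
    where "tr = (\<lambda>a b x. \<lambda>j\<in>{..<b}. \<lambda>k\<in>{..<a}. x k j)"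
  have tr_tr: "tr b a (tr a b x) = x" if "x \<in> {..<a} \<rightarrow>\<^sub>E words b" for a b x
  proof (intro ext)
    fix k j
    show "tr b a (tr a b x) k j = x k j"
    proof (cases "k < a")
      case True
      then have "x k \<in> words b" using that by (simp add: PiE_iff)
      then show ?thesis
        using True by (cases "j < b") (auto simp: tr_def words_def PiE_iff extensional_def)
    next
      case False
      then have "x k = undefined" using that by (simp add: PiE_iff extensional_def)
      then show ?thesis using False by (simp add: tr_def)
    qed
  qed
  have tr_in: "tr a b x \<in> {..<b} \<rightarrow>\<^sub>E words a" for a b x
    by (simp add: tr_def words_def)
  have "(\<Sum>x\<in>{..<L} \<rightarrow>\<^sub>E words n. \<Prod>j<n. \<gamma> (\<lambda>k\<in>{..<L}. x k j))
      = (\<Sum>x\<in>{..<n} \<rightarrow>\<^sub>E words L. \<Prod>j<n. \<gamma> (x j))"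
  proof (rule sum.reindex_bij_witness[where i = "tr n L" and j = "tr L n"])
    fix x :: "nat \<Rightarrow> nat \<Rightarrow> 'a"
    show "(\<Prod>j<n. \<gamma> (tr L n x j)) = (\<Prod>j<n. \<gamma> (\<lambda>k\<in>{..<L}. x k j))"
      by (simp add: tr_def)
  qed (simp_all only: tr_tr tr_in)
  also have "\<dots> = (\<Prod>j<n. \<Sum>z\<in>words L. \<gamma> z)"
    by (subst prod_sum_PiE) (auto simp: finite_words)
  finally show ?thesis by simp
qed

definition shell :: "('x \<Rightarrow> real) \<Rightarrow> nat \<Rightarrow> real \<Rightarrow> (nat \<Rightarrow> 'x) set" where
  "shell f n \<delta> = {x. (\<Sum>i<n. f (x i)) \<in> {-\<delta>..0}}"

text \<open>Conditioning on the shell makes every word of the support satisfy the cost constraint, so a random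
codebook is admissible with certainty and not merely on average.\<close>

definition shell_pmf :: "('x \<Rightarrow> real) \<Rightarrow> nat \<Rightarrow> 'x pmf \<Rightarrow> real \<Rightarrow> (nat \<Rightarrow> 'x) pmf" where
  "shell_pmf f n P \<delta> = cond_pmf (Pi_pmf {..<n} undefined (\<lambda>_. P)) (shell f n \<delta>)"

lemma set_Pi_pmf_words: "set_pmf (Pi_pmf {..<n} undefined p) \<subseteq> words n"
  by (auto simp: set_Pi_pmf PiE_dflt_def words_def PiE_def extensional_def)

lemma pmf_Pi_words:
  assumes "x \<in> words n"
  shows "pmf (Pi_pmf {..<n} undefined p) x = (\<Prod>i<n. pmf (p i) (x i))"
  using assms by (subst pmf_Pi') (auto simp: words_def PiE_def extensional_def)

lemma shell_prob_eq:
  "shell_prob f n P \<delta> = measure_pmf.prob (Pi_pmf {..<n} undefined (\<lambda>_. P)) (shell f n \<delta>)"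
proof -
  let ?p = "Pi_pmf {..<n} undefined (\<lambda>_. P)"
  have "measure_pmf.prob ?p (shell f n \<delta>) = measure_pmf.prob ?p (shell f n \<delta> \<inter> words n)"
    using set_Pi_pmf_words[of n "\<lambda>_. P"] measure_Int_set_pmf[of ?p "shell f n \<delta>"]
      measure_Int_set_pmf[of ?p "shell f n \<delta> \<inter> words n"]
    by (simp add: Int_assoc Int_absorb1)
  also have "\<dots> = (\<Sum>x\<in>words n \<inter> shell f n \<delta>. pmf ?p x)"
    by (subst measure_measure_pmf_finite) (auto simp: finite_words Int_commute)
  also have "\<dots> = (\<Sum>x\<in>words n. if x \<in> shell f n \<delta> then pmf ?p x else 0)"
    by (simp add: sum.inter_restrict finite_words)
  also have "\<dots> = shell_prob f n P \<delta>"
    unfolding shell_prob_def by (intro sum.cong) (auto simp: pmf_Pi_words shell_def)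
  finally show ?thesis by simp
qed

context
  fixes f :: "'x::finite \<Rightarrow> real" and n :: nat and P :: "'x pmf" and \<delta> :: real
  assumes Z: "shell_prob f n P \<delta> \<noteq> 0"
begin

lemma shell_prob_pos: "shell_prob f n P \<delta> > 0"
  using Z measure_nonneg unfolding shell_prob_eq by (simp add: zero_less_measure_iff)

lemma shell_meets_support: "set_pmf (Pi_pmf {..<n} undefined (\<lambda>_. P)) \<inter> shell f n \<delta> \<noteq> {}"
  using Z unfolding shell_prob_eq by (simp add: measure_pmf_zero_iff)

lemma set_shell_pmf: "set_pmf (shell_pmf f n P \<delta>) \<subseteq> words n \<inter> shell f n \<delta>"
  using set_Pi_pmf_words by (auto simp: shell_pmf_def set_cond_pmf[OF shell_meets_support])

lemma finite_set_shell_pmf: "finite (set_pmf (shell_pmf f n P \<delta>))"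
  using set_shell_pmf finite_words finite_subset by blast

text \<open>On the shell \<open>s * (\<delta> + \<Sum>i<n. f (x i)) \<ge> 0\<close>, hence the indicator of the shell is at most
\<open>exp (s * \<delta>) * exp (s * (\<Sum>i<n. f (x i)))\<close>. This restores, at the cost of a factor, the
product form that conditioning destroys.\<close>

lemma pmf_shell_pmf_le:
  assumes "s \<ge> 0" "x \<in> words n"
  shows "pmf (shell_pmf f n P \<delta>) x
       \<le> exp (s * \<delta>) / shell_prob f n P \<delta> * (\<Prod>i<n. pmf P (x i) * exp (s * f (x i)))"
proof (cases "x \<in> shell f n \<delta>")
  case True
  have "s * \<delta> + s * (\<Sum>i<n. f (x i)) = s * (\<delta> + (\<Sum>i<n. f (x i)))" by (simp add: algebra_simps)
  also have "\<dots> \<ge> 0" using True assms(1) by (simp add: shell_def)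
  finally have "1 \<le> exp (s * \<delta>) * exp (s * (\<Sum>i<n. f (x i)))"
    by (simp add: exp_add[symmetric])
  then have "(\<Prod>i<n. pmf P (x i)) * 1
      \<le> (\<Prod>i<n. pmf P (x i)) * (exp (s * \<delta>) * exp (s * (\<Sum>i<n. f (x i))))"
    by (intro mult_left_mono prod_nonneg) auto
  then have "(\<Prod>i<n. pmf P (x i)) \<le> exp (s * \<delta>) * (\<Prod>i<n. pmf P (x i) * exp (s * f (x i)))"
    by (simp add: exp_sum prod.distrib sum_distrib_left mult_ac)
  then show ?thesis
    using True assms(2) shell_prob_pos
    by (simp add: shell_pmf_def pmf_cond[OF shell_meets_support] pmf_Pi_words shell_prob_eq[symmetric]
        divide_right_mono)
next
  case False
  then show ?thesis
    using shell_prob_pos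
    by (auto simp: shell_pmf_def pmf_cond[OF shell_meets_support] intro!: divide_nonneg_nonneg mult_nonneg_nonneg prod_nonneg)
qed

lemma expectation_shell_pmf_prod_le:
  assumes s: "s \<ge> 0" and g: "\<And>i a. g i a \<ge> (0::real)"
  shows "measure_pmf.expectation (shell_pmf f n P \<delta>) (\<lambda>x. \<Prod>i<n. g i (x i))
       \<le> exp (s * \<delta>) / shell_prob f n P \<delta> * (\<Prod>i<n. \<Sum>a\<in>UNIV. pmf P a * exp (s * f a) * g i a)"
proof -
  let ?r = "exp (s * \<delta>) / shell_prob f n P \<delta>"
  have "measure_pmf.expectation (shell_pmf f n P \<delta>) (\<lambda>x. \<Prod>i<n. g i (x i))
      = (\<Sum>x\<in>words n. (\<Prod>i<n. g i (x i)) * pmf (shell_pmf f n P \<delta>) x)"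
    using set_shell_pmf by (intro integral_measure_pmf_real finite_words) auto
  also have "\<dots> \<le> (\<Sum>x\<in>words n. (\<Prod>i<n. g i (x i)) * (?r * (\<Prod>i<n. pmf P (x i) * exp (s * f (x i)))))"
    using s g by (intro sum_mono mult_left_mono pmf_shell_pmf_le prod_nonneg) auto
  also have "\<dots> = ?r * (\<Sum>x\<in>words n. \<Prod>i<n. pmf P (x i) * exp (s * f (x i)) * g i (x i))"
    by (simp add: sum_distrib_left prod.distrib mult_ac)
  finally show ?thesis
    by (simp only: sum_words_prod[where g = "\<lambda>i a. pmf P a * exp (s * f a) * g i a"])
qed

lemma random_coding_exponent_tensorizes:
  fixes W :: "'x \<Rightarrow> 'y::finite pmf"
  assumes s: "s \<ge> 0" and a: "a > 0"
  shows "(\<Sum>y\<in>words n. measure_pmf.expectation (shell_pmf f n P \<delta>)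
            (\<lambda>x. pmf (channel_output W n x) y powr (1 / a)) powr a)
       \<le> (exp (s * \<delta>) / shell_prob f n P \<delta>) powr a
         * (\<Sum>y\<in>UNIV. (\<Sum>x\<in>UNIV. pmf P x * exp (s * f x) * pmf (W x) y powr (1 / a)) powr a) ^ n"
proof -
  let ?r = "exp (s * \<delta>) / shell_prob f n P \<delta>"
  define h where "h = (\<lambda>y. \<Sum>x\<in>UNIV. pmf P x * exp (s * f x) * pmf (W x) y powr (1 / a))"
  have h: "h y \<ge> 0" for y unfolding h_def by (intro sum_nonneg) auto
  have r: "?r \<ge> 0" using shell_prob_pos by simp
  have "measure_pmf.expectation (shell_pmf f n P \<delta>)
            (\<lambda>x. pmf (channel_output W n x) y powr (1 / a)) powr a
      \<le> ?r powr a * (\<Prod>j<n. h (y j) powr a)" if y: "y \<in> words n" for y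
  proof -
    have "measure_pmf.expectation (shell_pmf f n P \<delta>) (\<lambda>x. pmf (channel_output W n x) y powr (1 / a))
        = measure_pmf.expectation (shell_pmf f n P \<delta>) (\<lambda>x. \<Prod>j<n. pmf (W (x j)) (y j) powr (1 / a))"
      by (simp add: pmf_channel_output[OF y] prod_powr_distrib)
    also have "\<dots> \<le> ?r * (\<Prod>j<n. h (y j))"
      unfolding h_def using s by (intro expectation_shell_pmf_prod_le) auto
    finally have "measure_pmf.expectation (shell_pmf f n P \<delta>)
            (\<lambda>x. pmf (channel_output W n x) y powr (1 / a)) powr a \<le> (?r * (\<Prod>j<n. h (y j))) powr a"
      using a by (intro powr_mono2) auto
    also have "\<dots> = ?r powr a * (\<Prod>j<n. h (y j) powr a)"
      using r h by (simp only: powr_mult prod_nonneg prod_powr_distrib)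
    finally show ?thesis .
  qed
  then have "(\<Sum>y\<in>words n. measure_pmf.expectation (shell_pmf f n P \<delta>)
            (\<lambda>x. pmf (channel_output W n x) y powr (1 / a)) powr a)
     \<le> (\<Sum>y\<in>words n. ?r powr a * (\<Prod>j<n. h (y j) powr a))"
    by (rule sum_mono)
  also have "\<dots> = ?r powr a * (\<Sum>y\<in>UNIV. h y powr a) ^ n"
    by (simp add: sum_distrib_left[symmetric] sum_words_prod[where g = "\<lambda>_ b. h b powr a"])
  finally show ?thesis by (simp add: h_def)
qed

lemma expurgated_exponent_tensorizes:
  fixes W :: "'x \<Rightarrow> 'y::finite pmf"
  assumes s: "s \<ge> 0"
  shows "measure_pmf.expectation (Pi_pmf {..<L} undefined (\<lambda>_. shell_pmf f n P \<delta>))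
            (bhattacharyya (channel_output W n) (words n) \<rho> {..<L})
       \<le> (exp (s * \<delta>) / shell_prob f n P \<delta>) ^ L
         * (\<Sum>x\<in>words L.
             (exp (s * (\<Sum>k<L. f (x k))) * (\<Prod>k<L. pmf P (x k)))
             * (\<Sum>y\<in>UNIV. \<Prod>i<L. pmf (W (x i)) y powr (1 / real L)) powr (1 / \<rho>)) ^ n"
proof -
  let ?r = "exp (s * \<delta>) / shell_prob f n P \<delta>"
  let ?q = "shell_pmf f n P \<delta>"
  define \<beta> where "\<beta> = (\<lambda>z. \<Sum>y\<in>UNIV. \<Prod>k<L. pmf (W (z k)) y powr (1 / real L))"
  define \<gamma> where "\<gamma> = (\<lambda>z. (\<Prod>k<L. pmf P (z k) * exp (s * f (z k))) * \<beta> z powr (1 / \<rho>))"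
  have \<beta>: "\<beta> z \<ge> 0" for z unfolding \<beta>_def by (intro sum_nonneg prod_nonneg) auto
  have cong: "\<gamma> (\<lambda>k\<in>{..<L}. x k) = \<gamma> x" for x :: "nat \<Rightarrow> 'x"
    unfolding \<gamma>_def \<beta>_def by simp
  have bhat: "bhattacharyya (channel_output W n) (words n) \<rho> {..<L} x
      = (\<Prod>j<n. \<beta> (\<lambda>k. x k j) powr (1 / \<rho>))" for x
  proof -
    have "(\<Prod>k<L. pmf (channel_output W n (x k)) y powr (1 / real L))
        = (\<Prod>j<n. \<Prod>k<L. pmf (W (x k j)) (y j) powr (1 / real L))" if "y \<in> words n" for y
      by (simp add: pmf_channel_output[OF that] prod_powr_distrib prod.swap[of _ "{..<L}"])
    then have "(\<Sum>y\<in>words n. \<Prod>k<L. pmf (channel_output W n (x k)) y powr (1 / real L))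
        = (\<Prod>j<n. \<beta> (\<lambda>k. x k j))"
      by (simp add: sum_words_prod[of "\<lambda>j a. \<Prod>k<L. pmf (W (x k j)) a powr (1 / real L)"] \<beta>_def)
    then show ?thesis
      using \<beta> by (simp add: bhattacharyya_def prod_powr_distrib)
  qed
  have "measure_pmf.expectation (Pi_pmf {..<L} undefined (\<lambda>_. ?q))
            (bhattacharyya (channel_output W n) (words n) \<rho> {..<L})
     = (\<Sum>x\<in>{..<L} \<rightarrow>\<^sub>E words n. bhattacharyya (channel_output W n) (words n) \<rho> {..<L} x
           * pmf (Pi_pmf {..<L} undefined (\<lambda>_. ?q)) x)"
  proof (rule integral_measure_pmf_real)
    show "finite ({..<L} \<rightarrow>\<^sub>E (words n :: (nat \<Rightarrow> 'x) set))"
      by (intro finite_PiE) (auto simp: finite_words)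
    show "x \<in> {..<L} \<rightarrow>\<^sub>E words n" if "x \<in> set_pmf (Pi_pmf {..<L} undefined (\<lambda>_. ?q))" for x
      using that set_shell_pmf by (auto simp: set_Pi_pmf PiE_dflt_def PiE_def extensional_def)
  qed
  also have "\<dots> \<le> (\<Sum>x\<in>{..<L} \<rightarrow>\<^sub>E words n. ?r ^ L * (\<Prod>j<n. \<gamma> (\<lambda>k\<in>{..<L}. x k j)))"
  proof (rule sum_mono)
    fix x :: "nat \<Rightarrow> nat \<Rightarrow> 'x" assume x: "x \<in> {..<L} \<rightarrow>\<^sub>E words n"
    have "pmf (Pi_pmf {..<L} undefined (\<lambda>_. ?q)) x = (\<Prod>k<L. pmf ?q (x k))"
      using x by (subst pmf_Pi') (auto simp: PiE_def extensional_def)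
    also have "\<dots> \<le> (\<Prod>k<L. ?r * (\<Prod>j<n. pmf P (x k j) * exp (s * f (x k j))))"
    proof (intro prod_mono conjI)
      fix k assume "k \<in> {..<L}"
      then have "x k \<in> words n" using x by blast
      with s show "pmf ?q (x k) \<le> ?r * (\<Prod>j<n. pmf P (x k j) * exp (s * f (x k j)))"
        by (rule pmf_shell_pmf_le)
    qed simp
    also have "\<dots> = ?r ^ L * (\<Prod>j<n. \<Prod>k<L. pmf P (x k j) * exp (s * f (x k j)))"
      by (subst prod.swap) (simp only: prod.distrib prod_constant card_lessThan)
    finally have "bhattacharyya (channel_output W n) (words n) \<rho> {..<L} x
           * pmf (Pi_pmf {..<L} undefined (\<lambda>_. ?q)) x
        \<le> (\<Prod>j<n. \<beta> (\<lambda>k. x k j) powr (1 / \<rho>))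
          * (?r ^ L * (\<Prod>j<n. \<Prod>k<L. pmf P (x k j) * exp (s * f (x k j))))"
      unfolding bhat by (intro mult_left_mono prod_nonneg) auto
    also have "\<dots> = ?r ^ L * (\<Prod>j<n. \<gamma> (\<lambda>k. x k j))"
      by (simp add: \<gamma>_def prod.distrib mult_ac)
    finally show "bhattacharyya (channel_output W n) (words n) \<rho> {..<L} x
           * pmf (Pi_pmf {..<L} undefined (\<lambda>_. ?q)) x
        \<le> ?r ^ L * (\<Prod>j<n. \<gamma> (\<lambda>k\<in>{..<L}. x k j))"
      by (simp add: cong)
  qed
  also have "\<dots> = ?r ^ L * (\<Sum>z\<in>words L. \<gamma> z) ^ n"
    by (simp add: sum_distrib_left[symmetric] sum_arrays_prod_columns)
  finally show ?thesis
    by (simp add: \<gamma>_def \<beta>_def prod.distrib exp_sum sum_distrib_left mult_ac)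
qed

end

section \<open>Codes for the constrained memoryless channel\<close>

definition ml_code :: "('x \<Rightarrow> 'y pmf) \<Rightarrow> nat \<Rightarrow> nat \<Rightarrow> nat \<Rightarrow> (nat \<Rightarrow> nat \<Rightarrow> 'x) \<Rightarrow> ('x, 'y) code" where
  "ml_code W n l M c = \<lparr>code_size = M, codeword = c,
     decoder = (\<lambda>y. top_list l {1..M} (\<lambda>j. pmf (channel_output W n (c j)) y))\<rparr>"

definition feasible :: "('x \<Rightarrow> real) \<Rightarrow> nat \<Rightarrow> (nat \<Rightarrow> 'x) set" where
  "feasible f n = {x \<in> words n. (\<Sum>j<n. f (x j)) \<le> 0}"

lemma avg_error_prob_ml_code:
  "avg_error_prob W n (ml_code W n l M c)
     = (\<Sum>i\<in>{1..M}. ml_error (channel_output W n) l {1..M} c i) / real M"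
  by (simp add: avg_error_prob_def error_prob_def ml_error_def ml_code_def)

lemma ml_code_is_list_code:
  assumes "l \<le> M" "M \<ge> 1" "c \<in> {1..M} \<rightarrow>\<^sub>E feasible f n"
  shows "list_code n l (ml_code W n l M c)"
proof -
  have "c i \<in> words n" if "i \<in> {1..M}" for i
    using PiE_mem[OF assms(3) that] by (simp add: feasible_def)
  moreover have "l \<le> card {1..M}" using assms by simp
  ultimately show ?thesis
    using assms(2) top_list(1,2)[of "{1..M}" l] by (simp add: list_code_def ml_code_def)
qed

lemma ml_code_satisfies_constraints:
  fixes f :: "'x::finite \<Rightarrow> real"
  assumes "n \<ge> 1" "c \<in> {1..M} \<rightarrow>\<^sub>E feasible f n"
  shows "satisfies_constraints n (input_constraints f) (ml_code W n l M c)"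
  using assms(1) PiE_mem[OF assms(2)] unfolding satisfies_constraints_def
  by (simp add: ml_code_def empirical_pmf_in_input_constraints_iff feasible_def)

text \<open>A mean cost of at most 0 forces some letter of cost at most 0, and repeating it gives a
feasible word. This provides codes even when every shell has probability 0 and all the bounds are
infinite.\<close>

lemma feasible_nonempty:
  fixes f :: "'x::finite \<Rightarrow> real"
  assumes "input_constraints f \<noteq> {}"
  shows "feasible f n \<noteq> {}"
proof -
  obtain P where P: "(\<Sum>x\<in>UNIV. pmf P x * f x) \<le> 0"
    using assms by (auto simp: input_constraints_def)
  have "\<exists>x. f x \<le> 0"
  proof (rule ccontr)
    assume "\<nexists>x. f x \<le> 0"
    then have pos: "f x > 0" for x by (simp add: not_le)
    obtain x where x: "x \<in> set_pmf P" using set_pmf_not_empty[of P] by blast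
    have "0 < pmf P x * f x" using x pos by (simp add: pmf_positive)
    also have "\<dots> \<le> (\<Sum>x\<in>UNIV. pmf P x * f x)"
      using less_imp_le[OF pos] by (intro member_le_sum mult_nonneg_nonneg) auto
    finally show False using P by simp
  qed
  then obtain a where "f a \<le> 0" by blast
  then have "(\<lambda>_\<in>{..<n}. a) \<in> feasible f n"
    by (auto simp: feasible_def words_def intro: mult_nonneg_nonpos)
  then show ?thesis by blast
qed

lemma set_shell_pmf_feasible:
  fixes f :: "'x::finite \<Rightarrow> real"
  assumes "shell_prob f n P \<delta> \<noteq> 0"
  shows "set_pmf (shell_pmf f n P \<delta>) \<subseteq> feasible f n"
  using set_shell_pmf[OF assms] by (auto simp: feasible_def shell_def)

lemma set_channel_output: "set_pmf (channel_output W n x) \<subseteq> words n"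
  unfolding channel_output_def by (rule set_Pi_pmf_words)

lemma exists_random_code:
  fixes W :: "'x::finite \<Rightarrow> 'y::finite pmf"
  assumes l: "l > 0" "l \<le> M" and Z: "shell_prob f n P \<delta> \<noteq> 0"
    and s: "s \<ge> 0" and \<rho>: "0 \<le> \<rho>" "\<rho> \<le> 1"
  defines "a \<equiv> 1 + real l * \<rho>"
  shows "\<exists>c\<in>{1..M} \<rightarrow>\<^sub>E feasible f n. avg_error_prob W n (ml_code W n l M c)
     \<le> real M powr (real l * \<rho>) * (exp (s * \<delta>) / shell_prob f n P \<delta>) powr a
        * (\<Sum>y\<in>UNIV. (\<Sum>x\<in>UNIV. pmf P x * exp (s * f x) * pmf (W x) y powr (1 / a)) powr a) ^ n"
proof -
  have a: "a > 0" using \<rho> by (simp add: a_def add_pos_nonneg)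
  obtain c where c: "c \<in> {1..M} \<rightarrow>\<^sub>E set_pmf (shell_pmf f n P \<delta>)"
    and err: "avg_error_prob W n (ml_code W n l M c)
       \<le> real M powr (real l * \<rho>) * (\<Sum>y\<in>words n. measure_pmf.expectation (shell_pmf f n P \<delta>)
            (\<lambda>x. pmf (channel_output W n x) y powr (1 / a)) powr a)"
    using random_coding_one_shot[where I = "{1..M}" and l = l and B = "words n" and \<rho> = \<rho>
        and q = "shell_pmf f n P \<delta>" and V = "channel_output W n"]
      l \<rho> finite_set_shell_pmf[OF Z] set_channel_output[of W n]
    by (auto simp: finite_words avg_error_prob_ml_code a_def)
  note err
  also have "real M powr (real l * \<rho>) * (\<Sum>y\<in>words n. measure_pmf.expectation (shell_pmf f n P \<delta>)
            (\<lambda>x. pmf (channel_output W n x) y powr (1 / a)) powr a)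
     \<le> real M powr (real l * \<rho>) * (exp (s * \<delta>) / shell_prob f n P \<delta>) powr a
        * (\<Sum>y\<in>UNIV. (\<Sum>x\<in>UNIV. pmf P x * exp (s * f x) * pmf (W x) y powr (1 / a)) powr a) ^ n"
    unfolding mult.assoc by (intro mult_left_mono random_coding_exponent_tensorizes[OF Z s a, unfolded mult.assoc]) auto
  finally have "avg_error_prob W n (ml_code W n l M c)
     \<le> real M powr (real l * \<rho>) * (exp (s * \<delta>) / shell_prob f n P \<delta>) powr a
        * (\<Sum>y\<in>UNIV. (\<Sum>x\<in>UNIV. pmf P x * exp (s * f x) * pmf (W x) y powr (1 / a)) powr a) ^ n" .
  moreover have "c \<in> {1..M} \<rightarrow>\<^sub>E feasible f n"
    using c set_shell_pmf_feasible[OF Z] PiE_mono by blast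
  ultimately show ?thesis by blast
qed

lemma exists_expurgated_code:
  fixes W :: "'x::finite \<Rightarrow> 'y::finite pmf"
  assumes l: "l > 0" "l \<le> M" and n: "n \<ge> 1" and Z: "shell_prob f n P \<delta> \<noteq> 0"
    and s: "s \<ge> 0" and \<rho>: "1 \<le> \<rho>"
  defines "L \<equiv> Suc l"
  shows "\<exists>c\<in>{1..M} \<rightarrow>\<^sub>E feasible f n. avg_error_prob W n (ml_code W n l M c)
     \<le> 2 powr (real L * \<rho>) * real M powr (real l * \<rho>)
        * (exp (s * \<delta>) / shell_prob f n P \<delta>) powr (real L * \<rho>)
        * (\<Sum>x\<in>words L.
             (exp (s * (\<Sum>k<L. f (x k))) * (\<Prod>k<L. pmf P (x k)))
             * (\<Sum>y\<in>UNIV. \<Prod>i<L. pmf (W (x i)) y powr (1 / real L)) powr (1 / \<rho>))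
          powr (\<rho> * real n)"
proof -
  let ?q = "shell_pmf f n P \<delta>"
  define r where "r = exp (s * \<delta>) / shell_prob f n P \<delta>"
  define G where "G = (\<Sum>x\<in>words L. (exp (s * (\<Sum>k<L. f (x k))) * (\<Prod>k<L. pmf P (x k)))
             * (\<Sum>y\<in>UNIV. \<Prod>i<L. pmf (W (x i)) y powr (1 / real L)) powr (1 / \<rho>))"
  define K where "K = measure_pmf.expectation (Pi_pmf {..<L} undefined (\<lambda>_. ?q))
      (bhattacharyya (channel_output W n) (words n) \<rho> {..<L})"
  have r: "r \<ge> 0" using shell_prob_pos[OF Z] by (simp add: r_def)
  have G: "G \<ge> 0" unfolding G_def by (intro sum_nonneg mult_nonneg_nonneg prod_nonneg) auto
  have K: "0 \<le> K" "K \<le> r ^ L * G ^ n"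
    using expurgated_exponent_tensorizes[OF Z s, of L W \<rho>]
    by (simp_all add: K_def r_def G_def bhattacharyya_nonneg)
  obtain c where c: "c \<in> {1..M} \<rightarrow>\<^sub>E set_pmf ?q"
    and err: "\<And>i. i \<in> {1..M} \<Longrightarrow> ml_error (channel_output W n) l {1..M} c i
       \<le> (2 * ((2 * real M) ^ l * K)) powr \<rho>"
    using expurgated_one_shot[where V = "channel_output W n" and d = undefined,
        OF l(2,1) finite_set_shell_pmf[OF Z] finite_words set_channel_output \<rho>]
    unfolding K_def L_def by blast
  have "avg_error_prob W n (ml_code W n l M c) \<le> (2 * ((2 * real M) ^ l * K)) powr \<rho>"
    using sum_bounded_above[of "{1..M}" "ml_error (channel_output W n) l {1..M} c", OF err] l
    by (simp add: avg_error_prob_ml_code divide_le_eq mult.commute)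
  also have "\<dots> \<le> (2 * ((2 * real M) ^ l * (r ^ L * G ^ n))) powr \<rho>"
    using K \<rho> by (intro powr_mono2 mult_left_mono) auto
  also have "2 * ((2 * real M) ^ l * (r ^ L * G ^ n)) = 2 ^ L * real M ^ l * r ^ L * G ^ n"
    by (simp add: L_def power_mult_distrib)
  also have "\<dots> powr \<rho> = 2 powr (real L * \<rho>) * real M powr (real l * \<rho>)
        * r powr (real L * \<rho>) * G powr (\<rho> * real n)"
  proof -
    have "L > 0" by (simp add: L_def)
    then show ?thesis
      using r G l(1) n by (simp add: powr_mult powr_powr mult.commute flip: powr_realpow')
  qed
  finally have "avg_error_prob W n (ml_code W n l M c)
      \<le> 2 powr (real L * \<rho>) * real M powr (real l * \<rho>) * r powr (real L * \<rho>) * G powr (\<rho> * real n)" .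
  moreover have "c \<in> {1..M} \<rightarrow>\<^sub>E feasible f n"
    using c set_shell_pmf_feasible[OF Z] PiE_mono by blast
  ultimately show ?thesis unfolding r_def G_def by blast
qed

theorem mainTheorem10:
  fixes W :: "'x::finite \<Rightarrow> 'y::finite pmf"
    and f :: "'x \<Rightarrow> real"
    and L n M :: nat
    and R :: real
  assumes "L \<ge> 2"
    and "n \<ge> 1"
    and "input_constraints f \<noteq> {}"
    and "M \<ge> L - 1"
    and "R = log 2 (real M) / real n"
  shows "(\<exists>C :: ('x, 'y) code. list_code n (L - 1) C \<and> code_rate n C = R \<and>
            satisfies_constraints n (input_constraints f) C \<and>
            ereal (avg_error_prob W n C) \<le>
              (INF P\<in>input_constraints f. INF \<delta>\<in>{0<..}. INF (s, \<rho>)\<in>{0..} \<times> {0..1}.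
                 random_coding_bound W f L n R P \<delta> s \<rho>)) \<and>
         (\<exists>C :: ('x, 'y) code. list_code n (L - 1) C \<and> code_rate n C = R \<and>
            satisfies_constraints n (input_constraints f) C \<and>
            ereal (avg_error_prob W n C) \<le>
              (INF P\<in>input_constraints f. INF \<delta>\<in>{0<..}. INF (s, \<rho>)\<in>{0..} \<times> {1..}.
                 expurgated_bound W f L n R P \<delta> s \<rho>))"
proof -
  define l where "l = L - 1"
  have l: "l > 0" "l \<le> M" and L: "L = Suc l" "real L - 1 = real l"
    using assms(1,4) by (auto simp: l_def)
  have M: "M \<ge> 1" using l by simp
  have rate: "2 powr (real n * R * real l * \<rho>) = real M powr (real l * \<rho>)" for \<rho>
  proof -
    have "real n * R * real l * \<rho> = log 2 (real M) * (real l * \<rho>)"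
      using assms(2,5) by simp
    then show ?thesis
      using M by (simp only: powr_powr[symmetric]) simp
  qed
  let ?F = "{1..M} \<rightarrow>\<^sub>E feasible f n"
  let ?e = "\<lambda>c. avg_error_prob W n (ml_code W n l M c)"
  have "finite ?F" by (intro finite_PiE) (auto simp: feasible_def finite_words)
  moreover have "?F \<noteq> {}" using feasible_nonempty[OF assms(3)] by (simp add: PiE_eq_empty_iff)
  \<comment> \<open>The infima need not be attained, so in general no single choice of parameters yields the code. A best
    codebook among the finitely many feasible ones is below every bound that some codebook meets.\<close>
  ultimately obtain c where c: "c \<in> ?F" "Min (?e ` ?F) = ?e c"
    by (rule obtains_MIN)
  have best: "?e c \<le> ?e c'" if "c' \<in> ?F" for c'
    using that \<open>finite ?F\<close> unfolding c(2)[symmetric] by (intro Min_le) auto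
  have "ereal (?e c) \<le> random_coding_bound W f L n R P \<delta> s \<rho>"
    if "s \<ge> 0" "0 \<le> \<rho>" "\<rho> \<le> 1" for P \<delta> s \<rho>
  proof (cases "shell_prob f n P \<delta> = 0")
    case True
    then show ?thesis by (simp add: random_coding_bound_def)
  next
    case False
    from exists_random_code[OF l False that, of W] best show ?thesis
      using False by (auto simp: random_coding_bound_def Let_def L(2) rate intro: order_trans)
  qed
  then have rc: "ereal (?e c) \<le> (INF P\<in>input_constraints f. INF \<delta>\<in>{0<..}. INF (s, \<rho>)\<in>{0..} \<times> {0..1}.
                 random_coding_bound W f L n R P \<delta> s \<rho>)"
    by (auto intro!: INF_greatest)
  have "ereal (?e c) \<le> expurgated_bound W f L n R P \<delta> s \<rho>"
    if "s \<ge> 0" "1 \<le> \<rho>" for P \<delta> s \<rho>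
  proof (cases "shell_prob f n P \<delta> = 0")
    case True
    then show ?thesis by (simp add: expurgated_bound_def)
  next
    case False
    from exists_expurgated_code[OF l assms(2) False that, of W, folded L(1)] best show ?thesis
      using False by (auto simp: expurgated_bound_def Let_def L(2) rate intro: order_trans)
  qed
  then have ex: "ereal (?e c) \<le> (INF P\<in>input_constraints f. INF \<delta>\<in>{0<..}. INF (s, \<rho>)\<in>{0..} \<times> {1..}.
                 expurgated_bound W f L n R P \<delta> s \<rho>)"
    by (auto intro!: INF_greatest)
  have "code_rate n (ml_code W n l M c) = R"
    by (simp add: code_rate_def ml_code_def assms(5))
  then show ?thesis
    using rc ex ml_code_is_list_code[OF l(2) M c(1)] ml_code_satisfies_constraints[OF assms(2) c(1)]
    unfolding l_def by blast
qed

end
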